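(* Let $\omega=(\theta,\epsilon)$ with $\theta\in(0,1)$ and $\epsilon\in\{-1,1\}$. Then the first return time ${\sf n}(z)=\min\{k\ge1:\ T_\omega^k(z)\in\mathcal X^{\mathrm{ind}}_\omega\}$ and the first return map $T^{\mathrm{ind}}_\omega(z)=T_\omega^{{\sf n}(z)}(z)$ are well defined for $z\in\mathcal X^{\mathrm{ind}}_\omega$, and for all $z\in\mathcal X_{S(\omega)}$ $$\psi_\omega\circ T^{\mathrm{ind}}_\omega\circ\psi_\omega^{-1}(z)=T_{S(\omega)}(z).$$
   Context: For $\theta\in[0,1)$ let $\mathcal C=[0,1]^2$, $\mathcal R_\theta=[1,1+\theta]\times[0,1]$, $\mathcal X_\theta=\mathcal C\cup\mathcal R_\theta$ and $\mathcal D_\theta=\partial\mathcal C\cup\partial\mathcal R_\theta$. Let $\Omega=[0,1)\times\{-1,1\}$, $f_{-1}(x)=x$ and $f_1(x)=1-x$. For $\omega=(\theta,\epsilon)\in\Omega$ the map $T_\omega$ is defined on $\mathring{\mathcal C}\cup\mathring{\mathcal R}_\theta$ by $T_\omega(x,y)=(1+\theta-y,f_\epsilon(x))$ if $(x,y)\in\mathring{\mathcal C}$ and $T_\omega(x,y)=(x-1,1-y)$ if $(x,y)\in\mathring{\mathcal R}_\theta$. Put $\mathcal D_\omega=\bigcup_{k\ge0}T_\omega^{-k}(\mathcal D_\theta)$, $\mathcal X_\omega=\mathcal X_\theta\setminus\mathcal D_\omega$ (the set of points whose whole forward orbit is defined), $\mathcal C_\omega=\mathcal C\cap\mathcal X_\omega$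 and $\mathcal R_\omega=\mathcal R_\theta\cap\mathcal X_\omega$. For $\omega=(\theta,\epsilon)\in(0,1)\times\{-1,1\}$ put $n_\omega=\lfloor 1/f_\epsilon(\theta)\rfloor$ and $S(\omega)=\big(\tfrac1{f_\epsilon(\theta)}-n_\omega,\ (-1)^{n_\omega+1}\big)\in\Omega$. Define the similitude $\psi_\omega:\mathbb R^2\to\mathbb R^2$ by $\psi_{(\theta,-1)}(x,y)=\frac1\theta(y,x)$ and $\psi_{(\theta,1)}(x,y)=\frac1{1-\theta}(x,y-\theta)$. The induction zones are $\mathcal C^{\mathrm{ind}}_\omega=\psi_\omega^{-1}(\mathcal C_{S(\omega)})$, $\mathcal R^{\mathrm{ind}}_\omega=\psi_\omega^{-1}(\mathcal R_{S(\omega)})$ and $\mathcal X^{\mathrm{ind}}_\omega=\mathcal C^{\mathrm{ind}}_\omega\cup\mathcal R^{\mathrm{ind}}_\omega$. *)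

theory Defs
  imports "HOL-Analysis.Analysis"
begin

definition square :: "(real \<times> real) set"
  where "square = {0..1} \<times> {0..1}"

definition rect :: "real \<Rightarrow> (real \<times> real) set"
  where "rect \<theta> = {1..1 + \<theta>} \<times> {0..1}"

definition table :: "real \<Rightarrow> (real \<times> real) set"
  where "table \<theta> = square \<union> rect \<theta>"

definition bdry :: "real \<Rightarrow> (real \<times> real) set"
  where "bdry \<theta> = frontier square \<union> frontier (rect \<theta>)"

text \<open>
  A parameter is a pair \<open>(\<theta>, \<epsilon>)\<close> with \<open>\<epsilon>\<close> an integer. The definitions below are only
  meaningful for \<open>\<epsilon>\<close> equal to -1 or 1; the value at any other \<open>\<epsilon>\<close> is junk.
\<close>

definition fold_map :: "int \<Rightarrow> real \<Rightarrow> real"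
  where "fold_map \<epsilon> x = (if \<epsilon> = -1 then x else 1 - x)"

text \<open>
  The maps are partial: they are undefined (\<open>None\<close>) off the two open rectangles, and the
  \<open>k\<close>-th iterate is defined only at points where all intermediate steps are.
\<close>

fun pet :: "real \<times> int \<Rightarrow> real \<times> real \<rightharpoonup> real \<times> real"
  where "pet (\<theta>, \<epsilon>) (x, y) =
    (if (x, y) \<in> interior square then Some (1 + \<theta> - y, fold_map \<epsilon> x)
     else if (x, y) \<in> interior (rect \<theta>) then Some (x - 1, 1 - y)
     else None)"

primrec pet_iter :: "real \<times> int \<Rightarrow> nat \<Rightarrow> real \<times> real \<rightharpoonup> real \<times> real"
  where
    "pet_iter \<omega> 0 = Some"
  | "pet_iter \<omega> (Suc k) = pet \<omega> \<circ>\<^sub>m pet_iter \<omega> k"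

definition singular_set :: "real \<times> int \<Rightarrow> (real \<times> real) set"
  where "singular_set \<omega> = (\<Union>k. {z. \<exists>w\<in>bdry (fst \<omega>). pet_iter \<omega> k z = Some w})"

definition reg_table :: "real \<times> int \<Rightarrow> (real \<times> real) set"
  where "reg_table \<omega> = table (fst \<omega>) - singular_set \<omega>"

definition reg_square :: "real \<times> int \<Rightarrow> (real \<times> real) set"
  where "reg_square \<omega> = square \<inter> reg_table \<omega>"

definition reg_rect :: "real \<times> int \<Rightarrow> (real \<times> real) set"
  where "reg_rect \<omega> = rect (fst \<omega>) \<inter> reg_table \<omega>"

text \<open>For \<open>\<theta>\<close> strictly between 0 and 1 the quotient is above 1, so \<open>nat\<close> truncates nothing.\<close>

fun renorm_count :: "real \<times> int \<Rightarrow> nat"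
  where "renorm_count (\<theta>, \<epsilon>) = nat \<lfloor>1 / fold_map \<epsilon> \<theta>\<rfloor>"

fun renorm :: "real \<times> int \<Rightarrow> real \<times> int"
  where "renorm (\<theta>, \<epsilon>) =
    (1 / fold_map \<epsilon> \<theta> - real (renorm_count (\<theta>, \<epsilon>)), (-1) ^ (renorm_count (\<theta>, \<epsilon>) + 1))"

fun simil :: "real \<times> int \<Rightarrow> real \<times> real \<Rightarrow> real \<times> real"
  where "simil (\<theta>, \<epsilon>) (x, y) =
    (if \<epsilon> = -1 then (1 / \<theta>) *\<^sub>R (y, x) else (1 / (1 - \<theta>)) *\<^sub>R (x, y - \<theta>))"

lemma bij_simil:
  assumes "0 < \<theta>" and "\<theta> < 1"
  shows "bij (simil (\<theta>, \<epsilon>))"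
proof (rule bij_betw_byWitness)
  let ?g = "\<lambda>(u, v). if \<epsilon> = -1 then (\<theta> * v, \<theta> * u) else ((1 - \<theta>) * u, (1 - \<theta>) * v + \<theta>)"
  show "\<forall>z\<in>UNIV. ?g (simil (\<theta>, \<epsilon>) z) = z"
    using assms by auto
  show "\<forall>z\<in>UNIV. simil (\<theta>, \<epsilon>) (?g z) = z"
    using assms by auto
qed auto

definition ind_square :: "real \<times> int \<Rightarrow> (real \<times> real) set"
  where "ind_square \<omega> = simil \<omega> -` reg_square (renorm \<omega>)"

definition ind_rect :: "real \<times> int \<Rightarrow> (real \<times> real) set"
  where "ind_rect \<omega> = simil \<omega> -` reg_rect (renorm \<omega>)"

definition ind_zone :: "real \<times> int \<Rightarrow> (real \<times> real) set"
  where "ind_zone \<omega> = ind_square \<omega> \<union> ind_rect \<omega>"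

definition returns_at :: "real \<times> int \<Rightarrow> real \<times> real \<Rightarrow> nat \<Rightarrow> bool"
  where "returns_at \<omega> z k \<longleftrightarrow> 1 \<le> k \<and> (\<exists>w\<in>ind_zone \<omega>. pet_iter \<omega> k z = Some w)"

text \<open>The minimum below is meaningful only at points that return at some time.\<close>

definition return_time :: "real \<times> int \<Rightarrow> real \<times> real \<Rightarrow> nat"
  where "return_time \<omega> z = (LEAST k. returns_at \<omega> z k)"

definition return_map :: "real \<times> int \<Rightarrow> real \<times> real \<rightharpoonup> real \<times> real"
  where "return_map \<omega> z = pet_iter \<omega> (return_time \<omega> z) z"

end

(* The return map is computed explicitly. Let a = f_eps(theta), so that 1 = n a + a theta' with
   theta' the first component of S(omega). On a strip containing the induction zone, the third
   iterate of T translates by -a along the strip and flips it across. The rectangular zone returns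
   after one such block. The square zone is first moved to the far end of the strip (in two steps
   if eps = -1, in one step if eps = 1) and needs n - 1 blocks to come back, whence the sign
   (-1)^(n+1). *)
theory Submission
  imports Defs
begin

section \<open>The map on the two open rectangles and its regular points\<close>

lemma pet_square: "0 < x \<Longrightarrow> x < 1 \<Longrightarrow> 0 < y \<Longrightarrow> y < 1 \<Longrightarrow>
    pet (\<theta>, \<epsilon>) (x, y) = Some (1 + \<theta> - y, fold_map \<epsilon> x)"
  by (simp add: square_def interior_Times)

lemma pet_rect: "1 < x \<Longrightarrow> x < 1 + \<theta> \<Longrightarrow> 0 < y \<Longrightarrow> y < 1 \<Longrightarrow>
    pet (\<theta>, \<epsilon>) (x, y) = Some (x - 1, 1 - y)"
  by (simp add: square_def rect_def interior_Times)

declare pet.simps [simp del]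

text \<open>The term \<open>k = 0\<close> of \<open>singular_set\<close> already removes
  \<open>bdry\<close>, and a closed rectangle without its frontier is its interior. Regularity thus
  yields the strict inequalities that \<open>pet_square\<close> and \<open>pet_rect\<close> ask
  for.\<close>

lemma reg_table_cases:
  assumes "(x, y) \<in> reg_table (\<theta>, \<epsilon>)"
  obtains (square) "0 < x" "x < 1" "0 < y" "y < 1"
    | (rect) "1 < x" "x < 1 + \<theta>" "0 < y" "y < 1"
proof -
  have "(x, y) \<notin> bdry \<theta>"
  proof
    assume "(x, y) \<in> bdry \<theta>"
    then have "pet_iter (\<theta>, \<epsilon>) 0 (x, y) = Some (x, y)" "(x, y) \<in> bdry (fst (\<theta>, \<epsilon>))"
      by simp_all
    then have "(x, y) \<in> singular_set (\<theta>, \<epsilon>)"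
      unfolding singular_set_def by blast
    then show False
      using assms by (simp add: reg_table_def)
  qed
  moreover have "(x, y) \<in> table \<theta>"
    using assms by (simp add: reg_table_def)
  moreover have "closure square = square" "closure (rect \<theta>) = rect \<theta>"
    unfolding square_def rect_def by (simp_all add: closure_Times)
  ultimately have "(x, y) \<in> interior square \<or> (x, y) \<in> interior (rect \<theta>)"
    by (auto simp: table_def bdry_def frontier_def)
  then show thesis
    using that by (auto simp: square_def rect_def interior_Times)
qed

text \<open>\<open>pet_iter\<close> appends steps at the end of the orbit; here the first step is
  split off instead.\<close>

lemma pet_iter_Suc_shift: "pet \<omega> z = Some w \<Longrightarrow> pet_iter \<omega> (Suc k) z = pet_iter \<omega> k w"
  by (induction k) (simp_all add: map_comp_def)

text \<open>If the orbit of the image met \<open>bdry\<close> after \<open>k\<close> steps, that of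
  \<open>z\<close> would meet it after \<open>k + 1\<close>. Applied to the renormalized map, this
  later places the return point in the zone.\<close>

lemma pet_reg_table:
  assumes "z \<in> reg_table (\<theta>, \<epsilon>)" "0 \<le> \<theta>"
  obtains w where "pet (\<theta>, \<epsilon>) z = Some w" "w \<in> reg_table (\<theta>, \<epsilon>)"
proof -
  obtain x y where z: "z = (x, y)"
    by fastforce
  have "\<exists>w\<in>table \<theta>. pet (\<theta>, \<epsilon>) z = Some w"
  proof (rule reg_table_cases[OF assms(1)[unfolded z]])
    assume "0 < x" "x < 1" "0 < y" "y < 1"
    then show ?thesis
      using assms(2) unfolding z
      by (auto simp: pet_square table_def square_def rect_def fold_map_def)
  next
    assume "1 < x" "x < 1 + \<theta>" "0 < y" "y < 1"
    then show ?thesis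
      using assms(2) unfolding z by (auto simp: pet_rect table_def square_def rect_def)
  qed
  then obtain w where w: "w \<in> table \<theta>" "pet (\<theta>, \<epsilon>) z = Some w"
    by blast
  have "w \<notin> singular_set (\<theta>, \<epsilon>)"
  proof
    assume "w \<in> singular_set (\<theta>, \<epsilon>)"
    then obtain k v where "v \<in> bdry \<theta>" "pet_iter (\<theta>, \<epsilon>) k w = Some v"
      by (auto simp: singular_set_def)
    then have "v \<in> bdry (fst (\<theta>, \<epsilon>))" "pet_iter (\<theta>, \<epsilon>) (Suc k) z = Some v"
      using pet_iter_Suc_shift[OF w(2), of k] by simp_all
    then have "z \<in> singular_set (\<theta>, \<epsilon>)"
      unfolding singular_set_def by blast
    then show False
      using assms(1) by (simp add: reg_table_def)
  qed
  with w have "w \<in> reg_table (\<theta>, \<epsilon>)"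
    by (simp add: reg_table_def)
  with w(2) show thesis
    by (rule that)
qed

section \<open>Orbit segments outside a set, and first returns\<close>

text \<open>A segment of at least one step whose strictly intermediate points lie outside
  \<open>A\<close>; both ends are unconstrained. The length is left implicit, so that segments can
  be chained without counting steps.\<close>

inductive avoids :: "real \<times> int \<Rightarrow> (real \<times> real) set \<Rightarrow> real \<times> real \<Rightarrow> real \<times> real \<Rightarrow> bool"
  for \<omega> A z
  where
    start: "pet \<omega> z = Some w \<Longrightarrow> avoids \<omega> A z w"
  | step: "avoids \<omega> A z v \<Longrightarrow> v \<notin> A \<Longrightarrow> pet \<omega> v = Some w \<Longrightarrow> avoids \<omega> A z w"

lemma avoids_trans:
  assumes "avoids \<omega> A z v" "v \<notin> A" "avoids \<omega> A v w"
  shows "avoids \<omega> A z w"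
  using assms(3,1,2) by induction (blast intro: avoids.step)+

lemma avoids_pet_iter:
  assumes "avoids \<omega> A z w"
  shows "\<exists>k\<ge>1. pet_iter \<omega> k z = Some w \<and> (\<forall>j. 1 \<le> j \<and> j < k \<longrightarrow> pet_iter \<omega> j z \<notin> Some ` A)"
  using assms
proof induction
  case (start w)
  then show ?case
    by (intro exI[of _ 1]) (simp add: map_comp_def)
next
  case (step v w)
  then obtain k where k: "k \<ge> 1" "pet_iter \<omega> k z = Some v"
    "\<And>j. 1 \<le> j \<Longrightarrow> j < k \<Longrightarrow> pet_iter \<omega> j z \<notin> Some ` A"
    by blast
  have "pet_iter \<omega> j z \<notin> Some ` A" if "1 \<le> j" "j < Suc k" for j
    using k step.hyps that by (cases "j = k") auto
  with k(2) step.hyps show ?case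
    by (intro exI[of _ "Suc k"]) (simp add: map_comp_def)
qed

text \<open>The implicit length of the segment is a return time, and avoidance makes it the least
  one.\<close>

lemma return_map_eqI:
  assumes "avoids \<omega> (ind_zone \<omega>) z w" "w \<in> ind_zone \<omega>"
  shows "\<exists>k. returns_at \<omega> z k" "return_map \<omega> z = Some w"
proof -
  obtain k where k: "k \<ge> 1" "pet_iter \<omega> k z = Some w"
    "\<And>j. 1 \<le> j \<Longrightarrow> j < k \<Longrightarrow> pet_iter \<omega> j z \<notin> Some ` ind_zone \<omega>"
    using avoids_pet_iter[OF assms(1)] by blast
  have ret: "returns_at \<omega> z k"
    using k assms(2) by (auto simp: returns_at_def)
  then show "\<exists>k. returns_at \<omega> z k" ..
  have "return_time \<omega> z = k"
    unfolding return_time_def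
  proof (rule Least_equality)
    show "returns_at \<omega> z k" by (fact ret)
  next
    fix j
    assume "returns_at \<omega> z j"
    then show "k \<le> j"
      using k(3)[of j] by (force simp: returns_at_def not_less[symmetric])
  qed
  with k(2) show "return_map \<omega> z = Some w"
    by (simp add: return_map_def)
qed

section \<open>The induction zone in the original coordinates\<close>

lemma ind_zone_iff: "z \<in> ind_zone \<omega> \<longleftrightarrow> simil \<omega> z \<in> reg_table (renorm \<omega>)"
  by (auto simp: ind_zone_def ind_square_def ind_rect_def reg_square_def reg_rect_def
      reg_table_def table_def)

text \<open>The first bound makes \<open>n - 1\<close> a genuine number of blocks; the second says
  that the first component of \<open>renorm\<close> is nonnegative.\<close>

lemma nat_floor_inverse_bounds:
  fixes a :: real
  assumes "0 < a" "a < 1"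
  defines "n \<equiv> nat \<lfloor>1 / a\<rfloor>"
  shows "1 \<le> n" "real n * a \<le> 1"
proof -
  have "1 \<le> 1 / a"
    using assms by simp
  then have "1 \<le> \<lfloor>1 / a\<rfloor>"
    by simp
  then show "1 \<le> n"
    unfolding n_def by linarith
  have "real n \<le> 1 / a"
    using \<open>1 \<le> \<lfloor>1 / a\<rfloor>\<close> unfolding n_def by linarith
  then show "real n * a \<le> 1"
    using assms(1) by (simp only: pos_le_divide_eq)
qed

text \<open>The sign records the parity of the \<open>n\<close> reflections met by the square zone:
  one on the way to the far end of the strip and one in each of the \<open>n - 1\<close>
  blocks.\<close>

lemma fold_map_sign: "fold_map ((-1) ^ (n + 1)) x = (if even n then x else 1 - x)"
  by (simp add: fold_map_def)

text \<open>Undoing the similitude swaps the coordinates and scales by \<open>\<theta>\<close>. The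
  far edge \<open>1 + \<theta>'\<close> of the renormalized table becomes
  \<open>1 - (n - 1) * \<theta>\<close>, because
  \<open>n * \<theta> + \<theta> * \<theta>' = 1\<close>. Such bounding boxes are enough to show
  that a point is outside the zone.\<close>

lemma ind_zone_cases_neg:
  assumes "(x, y) \<in> ind_zone (\<theta>, -1)" "0 < \<theta>"
  obtains (square) "0 < x" "x < \<theta>" "0 < y" "y < \<theta>"
    | (rect) "0 < x" "x < \<theta>" "\<theta> < y" "y < 1 - (real (nat \<lfloor>1 / \<theta>\<rfloor>) - 1) * \<theta>"
proof -
  define n where "n = nat \<lfloor>1 / \<theta>\<rfloor>"
  have "(y / \<theta>, x / \<theta>) \<in> reg_table (renorm (\<theta>, -1))"
    using assms by (simp add: ind_zone_iff)
  then have "(y / \<theta>, x / \<theta>) \<in> reg_table (1 / \<theta> - real n, (-1) ^ (n + 1))"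
    by (simp add: fold_map_def n_def)
  then show thesis
  proof (cases rule: reg_table_cases)
    case square
    then show thesis
      using assms(2) by (intro that(1)) (simp_all add: zero_less_divide_iff)
  next
    case rect
    have "y < (1 + (1 / \<theta> - real n)) * \<theta>"
      using rect(2) assms(2) by (simp add: pos_divide_less_eq)
    also have "\<dots> = 1 - (real n - 1) * \<theta>"
      using assms(2) by (simp add: field_simps)
    finally show thesis
      using rect assms(2) by (intro that(2)) (simp_all add: zero_less_divide_iff n_def)
  qed
qed

text \<open>Here the scale is \<open>a = 1 - \<theta>\<close> and the axes keep their order, so the
  zone extends horizontally; its far edge \<open>1 - (n - 1) * a\<close> arises in the same
  way.\<close>

lemma ind_zone_cases_pos:
  assumes "(x, y) \<in> ind_zone (\<theta>, 1)" "\<theta> < 1"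
  obtains (square) "0 < x" "x < 1 - \<theta>" "\<theta> < y" "y < 1"
    | (rect) "1 - \<theta> < x" "x < 1 - (real (nat \<lfloor>1 / (1 - \<theta>)\<rfloor>) - 1) * (1 - \<theta>)" "\<theta> < y" "y < 1"
proof -
  define a where "a = 1 - \<theta>"
  have a: "0 < a"
    using assms(2) by (simp add: a_def)
  define n where "n = nat \<lfloor>1 / a\<rfloor>"
  have "(x / (1 - \<theta>), (y - \<theta>) / (1 - \<theta>)) \<in> reg_table (renorm (\<theta>, 1))"
    using assms by (simp add: ind_zone_iff)
  then have "(x / a, (y - \<theta>) / a) \<in> reg_table (1 / a - real n, (-1) ^ (n + 1))"
    by (simp add: fold_map_def n_def a_def)
  then show thesis
  proof (cases rule: reg_table_cases)
    case square
    then show thesis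
      using a by (intro that(1)) (simp_all add: zero_less_divide_iff a_def)
  next
    case rect
    have "x < (1 + (1 / a - real n)) * a"
      using rect(2) a by (simp add: pos_divide_less_eq)
    also have "\<dots> = 1 - (real n - 1) * a"
      using a by (simp add: field_simps)
    finally show thesis
      using rect a by (intro that(2)) (simp_all add: zero_less_divide_iff n_def a_def)
  qed
qed

section \<open>Blocks of three steps along the strip\<close>

text \<open>The itinerary is square, square, rectangle: \<open>\<theta> < y\<close> keeps the first
  image in the square, and \<open>x < \<theta>\<close> then sends the second one into the
  rectangle.\<close>

lemma block_neg:
  assumes "0 < x" "x < \<theta>" "\<theta> < y" "y < 1"
  shows "avoids (\<theta>, -1) (ind_zone (\<theta>, -1)) (x, y) (\<theta> - x, y - \<theta>)"
proof -
  let ?A = "ind_zone (\<theta>, -1)"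
  \<comment> \<open>Both intermediate points have first coordinate above \<open>\<theta>\<close>,
    where the zone has no points.\<close>
  have out: "(u, v) \<notin> ?A" if "\<theta> < u" for u v
    using that assms by (auto elim: ind_zone_cases_neg)
  have "avoids (\<theta>, -1) ?A (x, y) (1 + \<theta> - y, x)"
    using assms by (intro avoids.start) (simp add: pet_square fold_map_def)
  then have "avoids (\<theta>, -1) ?A (x, y) (1 + \<theta> - x, 1 + \<theta> - y)"
    by (rule avoids.step) (use assms out in \<open>auto simp: pet_square fold_map_def\<close>)
  then show ?thesis
    by (rule avoids.step) (use assms out in \<open>auto simp: pet_rect\<close>)
qed

text \<open>The itinerary is again square, square, rectangle, now with
  \<open>1 - \<theta> < x\<close> sending the second image into the rectangle.\<close>

lemma block_pos:
  assumes "1 - \<theta> < x" "x < 1" "\<theta> < y" "y < 1" "0 < \<theta>"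
  shows "avoids (\<theta>, 1) (ind_zone (\<theta>, 1)) (x, y) (x - (1 - \<theta>), 1 + \<theta> - y)"
proof -
  let ?A = "ind_zone (\<theta>, 1)"
  have out: "(u, v) \<notin> ?A" if "v < \<theta>" for u v
    using that assms by (auto elim: ind_zone_cases_pos)
  have "avoids (\<theta>, 1) ?A (x, y) (1 + \<theta> - y, 1 - x)"
    using assms by (intro avoids.start) (simp add: pet_square fold_map_def)
  then have "avoids (\<theta>, 1) ?A (x, y) (\<theta> + x, y - \<theta>)"
    by (rule avoids.step) (use assms out in \<open>auto simp: pet_square fold_map_def\<close>)
  \<comment> \<open>The height \<open>y - \<theta>\<close> may exceed \<open>\<theta>\<close>, so
    \<open>out\<close> does not apply. Instead \<open>\<theta> + x\<close> is above 1, whereas the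
    zone ends at or before 1 because \<open>n\<close> is at least 1.\<close>
  moreover have "(\<theta> + x, y - \<theta>) \<notin> ?A"
  proof
    assume "(\<theta> + x, y - \<theta>) \<in> ?A"
    moreover have \<theta>: "\<theta> < 1"
      using assms(3,4) by linarith
    moreover have "0 \<le> (real (nat \<lfloor>1 / (1 - \<theta>)\<rfloor>) - 1) * (1 - \<theta>)"
      using nat_floor_inverse_bounds(1)[of "1 - \<theta>"] \<theta> assms(5)
      by (intro mult_nonneg_nonneg) linarith+
    ultimately show False
      using assms(1,5) by (elim ind_zone_cases_pos) linarith+
  qed
  ultimately show ?thesis
    by (rule avoids.step) (use assms in \<open>auto simp: pet_rect\<close>)
qed

text \<open>For positive \<open>j\<close> the last hypothesis reads
  \<open>1 - (n - 1) * \<theta> \<le> y - (j - 1) * \<theta>\<close>: the last block still starts at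
  or beyond the far edge of the zone, and the earlier ones start farther out. Only the endpoint may
  lie in the zone.\<close>

lemma blocks_neg:
  fixes \<theta> x y :: real
  defines "n \<equiv> nat \<lfloor>1 / \<theta>\<rfloor>"
  assumes "avoids (\<theta>, -1) (ind_zone (\<theta>, -1)) z (x, y)"
    and "0 < x" "x < \<theta>" "y < 1" "real j * \<theta> < y" "1 - y + real j * \<theta> \<le> real n * \<theta>"
  shows "avoids (\<theta>, -1) (ind_zone (\<theta>, -1)) z (if even j then x else \<theta> - x, y - real j * \<theta>)"
  using assms(6,7)
proof (induction j)
  case 0
  then show ?case
    using assms(2) by simp
next
  case (Suc j)
  let ?A = "ind_zone (\<theta>, -1)"
  let ?x = "if even j then x else \<theta> - x"
  have \<theta>: "0 < \<theta>"
    using assms(3,4) by linarith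
  have bounds: "real j * \<theta> + \<theta> < y" "1 - y + real j * \<theta> + \<theta> \<le> real n * \<theta>"
    using Suc.prems by (simp_all add: algebra_simps)
  have "avoids (\<theta>, -1) ?A z (?x, y - real j * \<theta>)"
    using Suc.IH bounds \<theta> by linarith
  \<comment> \<open>The first of \<open>bounds\<close> excludes the square part of the zone, the
    second its rectangular part.\<close>
  moreover have "(?x, y - real j * \<theta>) \<notin> ?A"
  proof
    assume "(?x, y - real j * \<theta>) \<in> ?A"
    then show False
      using \<theta> by (cases rule: ind_zone_cases_neg)
        (use bounds in \<open>auto simp: n_def algebra_simps\<close>)
  qed
  moreover have "avoids (\<theta>, -1) ?A (?x, y - real j * \<theta>) (\<theta> - ?x, y - real j * \<theta> - \<theta>)"
  proof (rule block_neg)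
    show "y - real j * \<theta> < 1"
      using assms(5) \<theta> by (smt (verit) mult_nonneg_nonneg of_nat_0_le_iff)
  qed (use assms(3,4) bounds in auto)
  ultimately have "avoids (\<theta>, -1) ?A z (\<theta> - ?x, y - real j * \<theta> - \<theta>)"
    by (rule avoids_trans)
  then show ?case
    by (auto simp: algebra_simps split: if_splits)
qed

text \<open>The same induction along the horizontal strip: the first coordinate drops by
  \<open>a\<close> in each block, and the flip reflects the second one within the interval from
  \<open>\<theta>\<close> to 1.\<close>

lemma blocks_pos:
  fixes \<theta> x y :: real
  defines "n \<equiv> nat \<lfloor>1 / (1 - \<theta>)\<rfloor>" and "a \<equiv> 1 - \<theta>"
  assumes "avoids (\<theta>, 1) (ind_zone (\<theta>, 1)) z (x, y)"
    and "0 < \<theta>" "\<theta> < y" "y < 1" "x < 1" "real j * a < x" "1 - x + real j * a \<le> real n * a"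
  shows "avoids (\<theta>, 1) (ind_zone (\<theta>, 1)) z (x - real j * a, if even j then y else 1 + \<theta> - y)"
  using assms(8,9)
proof (induction j)
  case 0
  then show ?case
    using assms(3) by simp
next
  case (Suc j)
  let ?A = "ind_zone (\<theta>, 1)"
  let ?y = "if even j then y else 1 + \<theta> - y"
  have \<theta>: "\<theta> < 1"
    using assms(5,6) by linarith
  then have a: "0 < a"
    by (simp add: a_def)
  have bounds: "real j * a + a < x" "1 - x + real j * a + a \<le> real n * a"
    using Suc.prems by (simp_all add: algebra_simps)
  have "avoids (\<theta>, 1) ?A z (x - real j * a, ?y)"
    using Suc.IH bounds a by linarith
  moreover have "(x - real j * a, ?y) \<notin> ?A"
  proof
    assume "(x - real j * a, ?y) \<in> ?A"
    then show False
      using \<theta> by (cases rule: ind_zone_cases_pos)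
        (use bounds in \<open>auto simp: n_def a_def left_diff_distrib\<close>)
  qed
  moreover have "avoids (\<theta>, 1) ?A (x - real j * a, ?y) (x - real j * a - (1 - \<theta>), 1 + \<theta> - ?y)"
  proof (rule block_pos)
    show "x - real j * a < 1"
      using assms(7) a by (smt (verit) mult_nonneg_nonneg of_nat_0_le_iff)
  qed (use assms(4-6) bounds in \<open>auto simp: a_def\<close>)
  ultimately have "avoids (\<theta>, 1) ?A z (x - real j * a - (1 - \<theta>), 1 + \<theta> - ?y)"
    by (rule avoids_trans)
  moreover have "x - real j * a - (1 - \<theta>) = x - real (Suc j) * a"
    by (simp add: a_def algebra_simps)
  ultimately show ?case
    by (auto split: if_splits)
qed

section \<open>Comparison with the renormalized map\<close>

text \<open>That \<open>q\<close> lies in the zone is left out on purpose: once \<open>simil\<close>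
  maps \<open>q\<close> to the renormalized image, it follows from the invariance of regular
  points.\<close>

lemma renormalization_neg:
  assumes "0 < \<theta>" "\<theta> < 1" "p \<in> ind_zone (\<theta>, -1)"
  shows "\<exists>q. avoids (\<theta>, -1) (ind_zone (\<theta>, -1)) p q
    \<and> pet (renorm (\<theta>, -1)) (simil (\<theta>, -1) p) = Some (simil (\<theta>, -1) q)"
proof -
  let ?A = "ind_zone (\<theta>, -1)"
  obtain x y where p: "p = (x, y)"
    by fastforce
  define n where "n = nat \<lfloor>1 / \<theta>\<rfloor>"
  have n: "1 \<le> n" "real n * \<theta> \<le> 1"
    using nat_floor_inverse_bounds[OF assms(1,2)] by (simp_all add: n_def)
  have S: "renorm (\<theta>, -1) = (1 / \<theta> - real n, (-1) ^ (n + 1))"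
    by (simp add: fold_map_def n_def)
  have simil: "simil (\<theta>, -1) (u, v) = (v / \<theta>, u / \<theta>)" for u v
    by simp
  from assms(3,1) show ?thesis
    unfolding p
  proof (cases rule: ind_zone_cases_neg)
    case square
    \<comment> \<open>Two steps lead to \<open>(\<theta> - y, 1 - x)\<close>; the remaining
      \<open>n - 1\<close> blocks lower the height by \<open>(n - 1) * \<theta>\<close> and reflect
      the first coordinate \<open>n - 1\<close> times.\<close>
    let ?q = "(if even (n - 1) then \<theta> - y else y, 1 - x - real (n - 1) * \<theta>)"
    have "avoids (\<theta>, -1) ?A (x, y) (1 + \<theta> - y, x)"
      using square assms by (intro avoids.start) (simp add: pet_square fold_map_def)
    moreover have "(1 + \<theta> - y, x) \<notin> ?A"
      using square assms by (auto elim!: ind_zone_cases_neg)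
    ultimately have "avoids (\<theta>, -1) ?A (x, y) (\<theta> - y, 1 - x)"
      by (rule avoids.step) (use square assms in \<open>simp add: pet_rect\<close>)
    \<comment> \<open>With \<open>j = n - 1\<close>, both size conditions of
      \<open>blocks_neg\<close> follow from \<open>x < \<theta>\<close> and
      \<open>n * \<theta> \<le> 1\<close>.\<close>
    then have "avoids (\<theta>, -1) ?A (x, y)
        (if even (n - 1) then \<theta> - y else \<theta> - (\<theta> - y), 1 - x - real (n - 1) * \<theta>)"
      by (rule blocks_neg)
        (use square assms n in \<open>auto simp: n_def[symmetric] of_nat_diff left_diff_distrib\<close>)
    moreover have "\<theta> - (\<theta> - y) = y"
      by simp
    ultimately have "avoids (\<theta>, -1) ?A (x, y) ?q"
      by (simp only:)
    moreover have "pet (renorm (\<theta>, -1)) (simil (\<theta>, -1) (x, y)) = Some (simil (\<theta>, -1) ?q)"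
      unfolding S simil using square n
      by (subst pet_square)
        (auto simp del: power_Suc simp: fold_map_sign[simplified] of_nat_diff field_simps)
    ultimately show "\<exists>q. avoids (\<theta>, -1) ?A (x, y) q
      \<and> pet (renorm (\<theta>, -1)) (simil (\<theta>, -1) (x, y)) = Some (simil (\<theta>, -1) q)"
      by blast
  next
    case rect
    \<comment> \<open>This brings the far edge of the zone down to at most 1, so that a single block
      applies.\<close>
    have "0 \<le> (real n - 1) * \<theta>"
      using n(1) assms(1) by simp
    then have "y < 1"
      using rect(4) unfolding n_def by linarith
    then have "avoids (\<theta>, -1) ?A (x, y) (\<theta> - x, y - \<theta>)"
      using rect by (intro block_neg)
    moreover have "pet (renorm (\<theta>, -1)) (simil (\<theta>, -1) (x, y)) = Some (simil (\<theta>, -1) (\<theta> - x, y - \<theta>))"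
      unfolding S simil using rect assms
      by (subst pet_rect) (auto simp: n_def field_simps)
    ultimately show "\<exists>q. avoids (\<theta>, -1) ?A (x, y) q
      \<and> pet (renorm (\<theta>, -1)) (simil (\<theta>, -1) (x, y)) = Some (simil (\<theta>, -1) q)"
      by blast
  qed
qed

lemma renormalization_pos:
  assumes "0 < \<theta>" "\<theta> < 1" "p \<in> ind_zone (\<theta>, 1)"
  shows "\<exists>q. avoids (\<theta>, 1) (ind_zone (\<theta>, 1)) p q
    \<and> pet (renorm (\<theta>, 1)) (simil (\<theta>, 1) p) = Some (simil (\<theta>, 1) q)"
proof -
  let ?A = "ind_zone (\<theta>, 1)"
  define a where "a = 1 - \<theta>"
  have a: "0 < a" "a < 1" "\<theta> = 1 - a"
    using assms by (simp_all add: a_def)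
  obtain x y where p: "p = (x, y)"
    by fastforce
  define n where "n = nat \<lfloor>1 / a\<rfloor>"
  have n: "1 \<le> n" "real n * a \<le> 1"
    using nat_floor_inverse_bounds[OF a(1,2)] by (simp_all add: n_def)
  have S: "renorm (\<theta>, 1) = (1 / a - real n, (-1) ^ (n + 1))"
    by (simp add: fold_map_def n_def a_def)
  have simil: "simil (\<theta>, 1) (u, v) = (u / a, (v - (1 - a)) / a)" for u v
    by (simp add: a_def)
  from assms(3,2) show ?thesis
    unfolding p
  proof (cases rule: ind_zone_cases_pos)
    case square
    \<comment> \<open>A single step leads to \<open>(1 + \<theta> - y, 1 - x)\<close>, already in
      the strip; for \<open>n = 1\<close> no block follows and this is \<open>q\<close>
      itself.\<close>
    let ?q = "(1 + \<theta> - y - real (n - 1) * a, if even (n - 1) then 1 - x else \<theta> + x)"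
    have "avoids (\<theta>, 1) ?A (x, y) (1 + \<theta> - y, 1 - x)"
      using square assms by (intro avoids.start) (simp add: pet_square fold_map_def)
    then have "avoids (\<theta>, 1) ?A (x, y)
        (1 + \<theta> - y - real (n - 1) * (1 - \<theta>), if even (n - 1) then 1 - x else 1 + \<theta> - (1 - x))"
      by (rule blocks_pos)
        (use square assms a(3) n in
          \<open>auto simp: n_def[symmetric] a_def[symmetric] of_nat_diff left_diff_distrib\<close>)
    moreover have "1 + \<theta> - (1 - x) = \<theta> + x"
      by simp
    ultimately have "avoids (\<theta>, 1) ?A (x, y) ?q"
      by (simp only: a_def)
    moreover have "pet (renorm (\<theta>, 1)) (simil (\<theta>, 1) (x, y)) = Some (simil (\<theta>, 1) ?q)"
      unfolding S simil using square n a
      by (subst pet_square)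
        (auto simp del: power_Suc simp: fold_map_sign[simplified] of_nat_diff field_simps)
    ultimately show "\<exists>q. avoids (\<theta>, 1) ?A (x, y) q
      \<and> pet (renorm (\<theta>, 1)) (simil (\<theta>, 1) (x, y)) = Some (simil (\<theta>, 1) q)"
      by blast
  next
    case rect
    have "0 \<le> (real n - 1) * a"
      using n(1) a(1) by simp
    then have "x < 1"
      using rect(2) unfolding n_def a_def by linarith
    then have "avoids (\<theta>, 1) ?A (x, y) (x - (1 - \<theta>), 1 + \<theta> - y)"
      using rect assms by (intro block_pos)
    moreover have "pet (renorm (\<theta>, 1)) (simil (\<theta>, 1) (x, y))
        = Some (simil (\<theta>, 1) (x - (1 - \<theta>), 1 + \<theta> - y))"
      unfolding S simil using rect[folded a_def, folded n_def] a
      by (subst pet_rect) (auto simp: field_simps)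
    ultimately show "\<exists>q. avoids (\<theta>, 1) ?A (x, y) q
      \<and> pet (renorm (\<theta>, 1)) (simil (\<theta>, 1) (x, y)) = Some (simil (\<theta>, 1) q)"
      by blast
  qed
qed

section \<open>Existence of the first return and the conjugacy\<close>

theorem proposition3p2:
  fixes \<theta> :: real and \<epsilon> :: int and \<omega> :: "real \<times> int"
  assumes "0 < \<theta>" and "\<theta> < 1" and "\<epsilon> \<in> {-1, 1}" and "\<omega> = (\<theta>, \<epsilon>)"
  shows "(\<forall>z\<in>ind_zone \<omega>. (\<exists>k. returns_at \<omega> z k) \<and> return_map \<omega> z \<noteq> None)
    \<and> (\<forall>z\<in>reg_table (renorm \<omega>).
          pet (renorm \<omega>) z \<noteq> None
        \<and> map_option (simil \<omega>) (return_map \<omega> (inv (simil \<omega>) z)) = pet (renorm \<omega>) z)"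
proof -
  have "0 < fold_map \<epsilon> \<theta>" "fold_map \<epsilon> \<theta> < 1"
    using assms(1,2) by (simp_all add: fold_map_def)
  \<comment> \<open>Nonnegativity of \<open>\<theta>'\<close> is what \<open>pet_reg_table\<close>
    asks of the renormalized parameter.\<close>
  from nat_floor_inverse_bounds(2)[OF this] this(1) have "0 \<le> fst (renorm \<omega>)"
    by (simp add: assms(4) field_simps)
  then obtain \<theta>' \<epsilon>' where S: "renorm \<omega> = (\<theta>', \<epsilon>')" "0 \<le> \<theta>'"
    by (metis prod.collapse)
  have main: "(\<exists>k. returns_at \<omega> p k) \<and> (\<exists>q. return_map \<omega> p = Some q
      \<and> pet (renorm \<omega>) (simil \<omega> p) = Some (simil \<omega> q))" if p: "p \<in> ind_zone \<omega>" for p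
  proof -
    have "\<exists>q. avoids \<omega> (ind_zone \<omega>) p q \<and> pet (renorm \<omega>) (simil \<omega> p) = Some (simil \<omega> q)"
      using assms p renormalization_neg renormalization_pos by blast
    then obtain q where q: "avoids \<omega> (ind_zone \<omega>) p q"
      "pet (renorm \<omega>) (simil \<omega> p) = Some (simil \<omega> q)"
      by blast
    have "simil \<omega> p \<in> reg_table (\<theta>', \<epsilon>')"
      using p by (simp add: ind_zone_iff S(1))
    then obtain w where "pet (\<theta>', \<epsilon>') (simil \<omega> p) = Some w" "w \<in> reg_table (\<theta>', \<epsilon>')"
      using S(2) by (rule pet_reg_table)
    \<comment> \<open>The renormalized image of a regular point is regular, and it equals
      \<open>simil \<omega> q\<close>; hence \<open>q\<close> is a return point and
      \<open>return_map_eqI\<close> applies.\<close>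
    then have "q \<in> ind_zone \<omega>"
      using q(2) by (simp add: ind_zone_iff S(1))
    with return_map_eqI[OF q(1)] q(2) show ?thesis
      by blast
  qed
  have "simil \<omega> (inv (simil \<omega>) z) = z" for z
    using bij_simil[OF assms(1,2)] by (simp add: assms(4) bij_is_surj surj_f_inv_f)
  with main show ?thesis
    by (metis ind_zone_iff option.distinct(1) option.map(2))
qed

end
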